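(* Let $\Delta$ be a reduced root system, let $\Pi$ be a basis of $\Delta$, and let $\Delta^+$ be the corresponding set of positive roots. Then there exists exactly one stem of $\Delta^+$.
   Context: For $\gamma\in\Delta^+$ put $\Phi_\gamma^+=\{\alpha\in\Delta^+ \mid \gamma-\alpha\in\Delta^+\}$. A subset $\Gamma\subset\Delta^+$ is called a stem of $\Delta^+$ if $\Delta^+=\Gamma\cup\bigcup_{\gamma\in\Gamma}\Phi_\gamma^+$ and this union is disjoint (i.e. the sets $\Gamma$ and $\Phi_\gamma^+$, $\gamma\in\Gamma$, are pairwise disjoint). The root system is not assumed irreducible. *)

theory Defs
  imports "HOL-Analysis.Analysis" "HOL-Library.Disjoint_Sets"
begin

definition reflection :: "'a::real_inner \<Rightarrow> 'a \<Rightarrow> 'a" where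
  "reflection \<alpha> x = x - (2 * (x \<bullet> \<alpha>) / (\<alpha> \<bullet> \<alpha>)) *\<^sub>R \<alpha>"

text \<open>The ambient Euclidean space of the root system is the subspace \<open>V = span \<Delta>\<close> of an inner
  product space; it is finite-dimensional because \<open>\<Delta>\<close> is finite.  Carrying \<open>V\<close> explicitly, rather
  than demanding that \<open>\<Delta>\<close> span a whole type of class \<open>euclidean_space\<close>, keeps the rank 0 case
  \<open>\<Delta> = {}\<close>, since the dimension of such a type is never 0.\<close>

definition root_system :: "'a::real_inner set \<Rightarrow> 'a set \<Rightarrow> bool" where
  "root_system V \<Delta> \<longleftrightarrow>
     finite \<Delta> \<and> 0 \<notin> \<Delta> \<and> span \<Delta> = V \<and>
     (\<forall>\<alpha>\<in>\<Delta>. reflection \<alpha> ` \<Delta> = \<Delta>) \<and>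
     (\<forall>\<alpha>\<in>\<Delta>. \<forall>\<beta>\<in>\<Delta>. 2 * (\<beta> \<bullet> \<alpha>) / (\<alpha> \<bullet> \<alpha>) \<in> \<int>)"

definition reduced_root_system :: "'a::real_inner set \<Rightarrow> 'a set \<Rightarrow> bool" where
  "reduced_root_system V \<Delta> \<longleftrightarrow>
     root_system V \<Delta> \<and> (\<forall>\<alpha>\<in>\<Delta>. \<forall>c. c *\<^sub>R \<alpha> \<in> \<Delta> \<longrightarrow> c = 1 \<or> c = - 1)"

definition root_basis :: "'a::real_inner set \<Rightarrow> 'a set \<Rightarrow> 'a set \<Rightarrow> bool" where
  "root_basis V \<Delta> B \<longleftrightarrow>
     B \<subseteq> \<Delta> \<and> independent B \<and> span B = V \<and>
     (\<forall>\<beta>\<in>\<Delta>. \<exists>c :: 'a \<Rightarrow> int. \<beta> = (\<Sum>\<alpha>\<in>B. of_int (c \<alpha>) *\<^sub>R \<alpha>) \<and>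
        ((\<forall>\<alpha>\<in>B. c \<alpha> \<ge> 0) \<or> (\<forall>\<alpha>\<in>B. c \<alpha> \<le> 0)))"

definition positive_roots :: "'a::real_inner set \<Rightarrow> 'a set \<Rightarrow> 'a set" where
  "positive_roots \<Delta> B =
     {\<beta> \<in> \<Delta>. \<exists>c :: 'a \<Rightarrow> int. \<beta> = (\<Sum>\<alpha>\<in>B. of_int (c \<alpha>) *\<^sub>R \<alpha>) \<and> (\<forall>\<alpha>\<in>B. c \<alpha> \<ge> 0)}"

definition Phi_plus :: "'a::real_inner set \<Rightarrow> 'a \<Rightarrow> 'a set" where
  "Phi_plus P \<gamma> = {\<alpha> \<in> P. \<gamma> - \<alpha> \<in> P}"

text \<open>Disjointness is that of the family indexed by \<open>\<Gamma>\<close>: distinct members of \<open>\<Gamma>\<close> must have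
  disjoint \<open>\<Phi>\<close>-sets, so these sets may coincide only when empty.\<close>

definition is_stem :: "'a::real_inner set \<Rightarrow> 'a set \<Rightarrow> bool" where
  "is_stem P \<Gamma> \<longleftrightarrow>
     \<Gamma> \<subseteq> P \<and>
     P = \<Gamma> \<union> (\<Union>\<gamma>\<in>\<Gamma>. Phi_plus P \<gamma>) \<and>
     (\<forall>\<gamma>\<in>\<Gamma>. \<Gamma> \<inter> Phi_plus P \<gamma> = {}) \<and>
     disjoint_family_on (Phi_plus P) \<Gamma>"

end

(* A linear functional h that is positive on the positive roots recovers the positive system, and
   this description, unlike the one by a basis, passes at once to subsystems. Let \<gamma> be a positive
   root of largest h-value. Adding a positive root to \<gamma> never gives a root, so \<gamma> has non-negative
   inner product with every positive root, and {\<gamma>} \<union> \<Phi>\<^sub>\<gamma> consists exactly of the positive roots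
   not orthogonal to \<gamma>. Maximality also forces \<gamma> into every stem, and the stems of \<Delta>\<^sup>+ correspond
   to the stems of the positive roots orthogonal to \<gamma>. Induct on the number of roots. *)
theory Submission
  imports Defs
begin

section \<open>Removing a maximal element from a stem\<close>

lemma Phi_plus_subset: "Phi_plus P \<gamma> \<subseteq> P"
  by (auto simp: Phi_plus_def)

text \<open>A stem partitions \<open>P\<close> into its elements and their blocks
  \<open>Phi_plus P \<delta>\<close>. Maximality keeps \<gamma> out of every block, so the covering
  condition forces \<gamma> into the stem. Deleting \<gamma> and its block leaves a partition of
  \<open>Q\<close>. Assumption \<open>Phi\<close> says that the remaining blocks are the same
  whether computed in \<open>P\<close> or in \<open>Q\<close>, so this is a stem of
  \<open>Q\<close>, and the step can be reversed.\<close>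

lemma is_stem_reduce:
  assumes "\<gamma> \<in> P" "0 \<notin> P"
    and maximal: "\<And>\<alpha>. \<alpha> \<in> P \<Longrightarrow> \<gamma> + \<alpha> \<notin> P"
    and Q: "Q = P - insert \<gamma> (Phi_plus P \<gamma>)"
    and Phi: "\<And>\<delta>. \<delta> \<in> Q \<Longrightarrow> Phi_plus P \<delta> = Phi_plus Q \<delta>"
  shows "is_stem P \<Gamma> \<longleftrightarrow> \<gamma> \<in> \<Gamma> \<and> is_stem Q (\<Gamma> - {\<gamma>})"
proof
  \<comment> \<open>If \<gamma> were in the block of \<delta>, then \<delta> - \<gamma> would lie in
    \<open>P\<close>, and adding it to \<gamma> would give \<delta>, an element of
    \<open>P\<close>.\<close>
  have notin: "\<gamma> \<notin> Phi_plus P \<delta>" if "\<delta> \<in> P" for \<delta>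
    using maximal[of "\<delta> - \<gamma>"] that by (auto simp: Phi_plus_def)
  {
    assume stem: "is_stem P \<Gamma>"
    then have sub: "\<Gamma> \<subseteq> P" and cover: "P = \<Gamma> \<union> (\<Union>\<delta>\<in>\<Gamma>. Phi_plus P \<delta>)"
      and disj: "\<And>\<delta>. \<delta> \<in> \<Gamma> \<Longrightarrow> \<Gamma> \<inter> Phi_plus P \<delta> = {}"
      and fam: "disjoint_family_on (Phi_plus P) \<Gamma>"
      by (auto simp: is_stem_def)
    have mem: "\<gamma> \<in> \<Gamma>"
      using \<open>\<gamma> \<in> P\<close> cover notin sub by blast
    have subQ: "\<Gamma> - {\<gamma>} \<subseteq> Q"
      using sub disj[OF mem] Q by blast
    have UN_eq: "(\<Union>\<delta>\<in>\<Gamma> - {\<gamma>}. Phi_plus P \<delta>) = (\<Union>\<delta>\<in>\<Gamma> - {\<gamma>}. Phi_plus Q \<delta>)"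
      using Phi subQ by (intro SUP_cong) auto
    have "Q \<subseteq> (\<Gamma> - {\<gamma>}) \<union> (\<Union>\<delta>\<in>\<Gamma> - {\<gamma>}. Phi_plus P \<delta>)"
      unfolding Q by (subst (1) cover) blast
    then have "Q = (\<Gamma> - {\<gamma>}) \<union> (\<Union>\<delta>\<in>\<Gamma> - {\<gamma>}. Phi_plus Q \<delta>)"
      unfolding UN_eq by (intro equalityI Un_least subQ UN_least Phi_plus_subset)
    moreover have "\<forall>\<delta>\<in>\<Gamma> - {\<gamma>}. (\<Gamma> - {\<gamma>}) \<inter> Phi_plus Q \<delta> = {}"
      using disj Phi subQ by blast
    moreover have "disjoint_family_on (Phi_plus Q) (\<Gamma> - {\<gamma>})"
      using fam Phi subQ unfolding disjoint_family_on_def by blast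
    ultimately show "\<gamma> \<in> \<Gamma> \<and> is_stem Q (\<Gamma> - {\<gamma>})"
      using mem subQ unfolding is_stem_def by blast
  }
  {
    assume "\<gamma> \<in> \<Gamma> \<and> is_stem Q (\<Gamma> - {\<gamma>})"
    then have mem: "\<gamma> \<in> \<Gamma>" and sub: "\<Gamma> - {\<gamma>} \<subseteq> Q"
      and cover: "Q = (\<Gamma> - {\<gamma>}) \<union> (\<Union>\<delta>\<in>\<Gamma> - {\<gamma>}. Phi_plus Q \<delta>)"
      and disj: "\<And>\<delta>. \<delta> \<in> \<Gamma> - {\<gamma>} \<Longrightarrow> (\<Gamma> - {\<gamma>}) \<inter> Phi_plus Q \<delta> = {}"
      and fam: "disjoint_family_on (Phi_plus Q) (\<Gamma> - {\<gamma>})"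
      by (auto simp: is_stem_def)
    have cover': "Q = (\<Gamma> - {\<gamma>}) \<union> (\<Union>\<delta>\<in>\<Gamma> - {\<gamma>}. Phi_plus P \<delta>)"
      by (subst cover, rule arg_cong2[where f = "(\<union>)", OF refl], rule SUP_cong)
        (use Phi sub in auto)
    have "P = insert \<gamma> (Phi_plus P \<gamma>) \<union> Q"
      using Q \<open>\<gamma> \<in> P\<close> Phi_plus_subset by blast
    also have "\<dots> = insert \<gamma> (Phi_plus P \<gamma>) \<union> ((\<Gamma> - {\<gamma>}) \<union> (\<Union>\<delta>\<in>\<Gamma> - {\<gamma>}. Phi_plus P \<delta>))"
      by (subst cover') (rule refl)
    also have "\<dots> = \<Gamma> \<union> (\<Union>\<delta>\<in>\<Gamma>. Phi_plus P \<delta>)"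
      using mem by auto
    finally have "P = \<Gamma> \<union> (\<Union>\<delta>\<in>\<Gamma>. Phi_plus P \<delta>)" .
    moreover have subP: "\<Gamma> \<subseteq> P"
      using sub Q \<open>\<gamma> \<in> P\<close> by blast
    \<comment> \<open>By \<open>notin\<close>, \<gamma> is in no block. The other elements of
      \<Gamma> lie in \<open>Q\<close>: this avoids the block of \<gamma>, and \<open>disj\<close>
      handles the remaining blocks.\<close>
    moreover have "\<forall>\<delta>\<in>\<Gamma>. \<Gamma> \<inter> Phi_plus P \<delta> = {}"
    proof
      fix \<delta> assume "\<delta> \<in> \<Gamma>"
      show "\<Gamma> \<inter> Phi_plus P \<delta> = {}"
      proof (cases "\<delta> = \<gamma>")
        case True
        then show ?thesis using sub Q notin[OF \<open>\<gamma> \<in> P\<close>] by blast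
      next
        case False
        then show ?thesis
          using disj[of \<delta>] Phi[of \<delta>] sub notin[of \<delta>] subP \<open>\<delta> \<in> \<Gamma>\<close> by blast
      qed
    qed
    moreover have "disjoint_family_on (Phi_plus P) \<Gamma>"
    proof -
      have "disjoint_family_on (Phi_plus P) (\<Gamma> - {\<gamma>})"
        using fam Phi sub unfolding disjoint_family_on_def by blast
      \<comment> \<open>The other blocks are contained in \<open>Q\<close>, which was defined to
        avoid the block of \<gamma>.\<close>
      moreover have "Phi_plus P \<gamma> \<inter> (\<Union>\<delta>\<in>\<Gamma> - {\<gamma>}. Phi_plus P \<delta>) = {}"
      proof -
        have "(\<Union>\<delta>\<in>\<Gamma> - {\<gamma>}. Phi_plus P \<delta>) \<subseteq> Q"
          by (subst cover') blast
        then show ?thesis using Q by blast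
      qed
      ultimately show ?thesis
        using disjoint_family_on_insert[of \<gamma> "\<Gamma> - {\<gamma>}" "Phi_plus P"] mem
        by (simp add: insert_absorb)
    qed
    ultimately show "is_stem P \<Gamma>"
      unfolding is_stem_def by blast
  }
qed

section \<open>Reflections, differences of roots and orthogonal subsystems\<close>

lemma reflection_root:
  assumes "root_system V \<Delta>" "\<alpha> \<in> \<Delta>" "\<beta> \<in> \<Delta>"
  shows "reflection \<alpha> \<beta> \<in> \<Delta>"
  using assms unfolding root_system_def by blast

lemma reflection_self: "reflection \<alpha> \<alpha> = - \<alpha>"
  by (cases "\<alpha> = 0") (auto simp: reflection_def scaleR_2)

lemma reflection_involution: "reflection \<alpha> (reflection \<alpha> x) = x"
  by (cases "\<alpha> = 0") (auto simp: reflection_def inner_diff_left algebra_simps)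

lemma minus_root:
  assumes "root_system V \<Delta>" "\<alpha> \<in> \<Delta>"
  shows "- \<alpha> \<in> \<Delta>"
  using reflection_root[OF assms assms(2)] by (simp add: reflection_self)

text \<open>The Cartan integer is positive. If it is 1, the reflection subtracts \<beta> exactly
  once; otherwise it is at least 2, which is the second alternative.\<close>

lemma Cartan_integer_cases:
  assumes "root_system V \<Delta>" "\<alpha> \<in> \<Delta>" "\<beta> \<in> \<Delta>" "\<alpha> \<bullet> \<beta> > 0"
  shows "reflection \<beta> \<alpha> = \<alpha> - \<beta> \<or> \<beta> \<bullet> \<beta> \<le> \<alpha> \<bullet> \<beta>"
proof -
  have pos: "\<beta> \<bullet> \<beta> > 0"
    using assms(4) by (auto simp: inner_gt_zero_iff)
  have "2 * (\<alpha> \<bullet> \<beta>) / (\<beta> \<bullet> \<beta>) \<in> \<int>"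
    using assms unfolding root_system_def by blast
  then obtain k :: int where k: "2 * (\<alpha> \<bullet> \<beta>) / (\<beta> \<bullet> \<beta>) = of_int k"
    by (auto elim: Ints_cases)
  have "of_int k > (0::real)"
    using pos assms(4) by (simp flip: k)
  then consider "k = 1" | "k \<ge> 2" by force
  then show ?thesis
  proof cases
    case 1
    then show ?thesis using k by (simp add: reflection_def)
  next
    case 2
    then have "2 \<le> 2 * (\<alpha> \<bullet> \<beta>) / (\<beta> \<bullet> \<beta>)" by (simp add: k)
    then show ?thesis using pos by (simp add: field_simps)
  qed
qed

text \<open>If neither reflection produces the difference up to sign, then both Cartan integers are
  at least 2. Hence \<alpha> \<bullet> \<beta> bounds both squared lengths, and the squared length
  of \<alpha> - \<beta> is at most 0.\<close>

lemma diff_root: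
  assumes "root_system V \<Delta>" "\<alpha> \<in> \<Delta>" "\<beta> \<in> \<Delta>" "\<alpha> \<bullet> \<beta> > 0" "\<alpha> \<noteq> \<beta>"
  shows "\<alpha> - \<beta> \<in> \<Delta>"
proof (rule ccontr)
  assume no: "\<alpha> - \<beta> \<notin> \<Delta>"
  then have "\<beta> - \<alpha> \<notin> \<Delta>"
    using minus_root[OF assms(1), of "\<beta> - \<alpha>"] by auto
  then have "\<beta> \<bullet> \<beta> \<le> \<alpha> \<bullet> \<beta>" "\<alpha> \<bullet> \<alpha> \<le> \<alpha> \<bullet> \<beta>"
    using no Cartan_integer_cases[OF assms(1-4)] Cartan_integer_cases[OF assms(1,3,2)] assms(4)
      reflection_root[OF assms(1)] assms(2,3) by (metis inner_commute)+
  then have "(\<alpha> - \<beta>) \<bullet> (\<alpha> - \<beta>) \<le> 0"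
    by (simp add: inner_diff_left inner_diff_right inner_commute)
  then show False
    using assms(5) by (simp flip: not_less)
qed

text \<open>This is the system to which the induction descends. Reflecting in a root orthogonal to
  \<gamma> does not change inner products with \<gamma>, so the subset is mapped into itself; as a
  reflection is an involution, the image is the whole subset.\<close>

lemma root_system_orthogonal:
  assumes "root_system V \<Delta>"
  shows "root_system (span {\<alpha> \<in> \<Delta>. \<gamma> \<bullet> \<alpha> = 0}) {\<alpha> \<in> \<Delta>. \<gamma> \<bullet> \<alpha> = 0}" (is "root_system _ ?D")
proof -
  have refl: "reflection \<alpha> ` ?D = ?D" if "\<alpha> \<in> ?D" for \<alpha>
  proof -
    have sub: "reflection \<alpha> ` ?D \<subseteq> ?D"
      using that reflection_root[OF assms] by (auto simp: reflection_def inner_diff_right)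
    then have "x \<in> reflection \<alpha> ` ?D" if "x \<in> ?D" for x
      using that by (intro image_eqI[of _ _ "reflection \<alpha> x"]) (auto simp: reflection_involution)
    with sub show ?thesis by blast
  qed
  then show ?thesis
    using assms unfolding root_system_def by auto
qed

section \<open>Induction for positive systems cut out by a functional\<close>

lemma stem_unique_functional:
  fixes h :: "'a::real_inner \<Rightarrow> real"
  assumes "linear h" "root_system V \<Delta>" "\<And>\<alpha>. \<alpha> \<in> \<Delta> \<Longrightarrow> h \<alpha> \<noteq> 0"
  shows "\<exists>!\<Gamma>. is_stem {\<alpha> \<in> \<Delta>. h \<alpha> > 0} \<Gamma>"
  using assms(2,3)
\<comment> \<open>The space \<open>V\<close> varies because the subsystem spans a smaller one;
  \<open>h\<close> stays fixed and also cuts out the positive part of the subsystem.\<close>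
proof (induction "card \<Delta>" arbitrary: V \<Delta> rule: less_induct)
  case less
  define P where "P = {\<alpha> \<in> \<Delta>. h \<alpha> > 0}"
  have fin: "finite \<Delta>" and zero: "0 \<notin> P"
    using less.prems(1) by (auto simp: root_system_def P_def)
  have P_or: "\<alpha> \<in> P \<or> - \<alpha> \<in> P" if "\<alpha> \<in> \<Delta>" for \<alpha>
    using that less.prems(2)[OF that] minus_root[OF less.prems(1) that] linear_neg[OF assms(1)]
    by (auto simp: P_def)
  show ?case
  proof (cases "P = {}")
    case True
    then show ?thesis
      by (auto simp: P_def[symmetric] is_stem_def disjoint_family_on_def)
  next
    case False
    have "finite P" using fin by (simp add: P_def)
    then obtain \<gamma> where "\<gamma> \<in> P" and top: "\<And>\<alpha>. \<alpha> \<in> P \<Longrightarrow> h \<alpha> \<le> h \<gamma>"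
      using False Max_in[of "h ` P"] Max_ge[of "h ` P"] by fastforce
    then have "\<gamma> \<in> \<Delta>" by (simp add: P_def)
    \<comment> \<open>The sum has a larger \<open>h\<close>-value than \<gamma>, so if it were a
      root it would be a positive one beyond the maximum.\<close>
    have maximal: "\<gamma> + \<alpha> \<notin> \<Delta>" if "\<alpha> \<in> P" for \<alpha>
      using that top[of "\<gamma> + \<alpha>"] \<open>\<gamma> \<in> P\<close> linear_add[OF assms(1)] by (auto simp: P_def)
    have dominant: "\<gamma> \<bullet> \<alpha> \<ge> 0" if "\<alpha> \<in> P" for \<alpha>
    proof (rule ccontr)
      assume neg: "\<not> \<gamma> \<bullet> \<alpha> \<ge> 0"
      have "\<gamma> \<noteq> - \<alpha>"
        using \<open>\<gamma> \<in> P\<close> that linear_neg[OF assms(1)] by (auto simp: P_def)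
      \<comment> \<open>A negative product with \<alpha> is a positive product with the root
        -\<alpha>, so the difference lemma would make \<gamma> + \<alpha> a root.\<close>
      then have "\<gamma> - (- \<alpha>) \<in> \<Delta>"
        using neg diff_root[OF less.prems(1) \<open>\<gamma> \<in> \<Delta>\<close> minus_root[OF less.prems(1)], of \<alpha>] that
        by (auto simp: P_def)
      then show False using maximal[OF that] by simp
    qed
    have in_Phi: "\<alpha> \<in> Phi_plus P \<gamma>" if "\<alpha> \<in> P" "\<gamma> \<bullet> \<alpha> > 0" "\<alpha> \<noteq> \<gamma>" for \<alpha>
    proof -
      have "\<gamma> - \<alpha> \<in> \<Delta>"
        using diff_root[OF less.prems(1) \<open>\<gamma> \<in> \<Delta>\<close>] that by (auto simp: P_def)
      \<comment> \<open>Otherwise \<alpha> would be the sum of \<gamma> and a positive root. So of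
        the two roots \<gamma> - \<alpha> and \<alpha> - \<gamma>, the first is the positive
        one.\<close>
      moreover have "\<alpha> - \<gamma> \<notin> P"
        using maximal[of "\<alpha> - \<gamma>"] that by (auto simp: P_def)
      ultimately show ?thesis
        using P_or[of "\<gamma> - \<alpha>"] that by (auto simp: Phi_plus_def)
    qed
    have Phi_not_orth: "\<gamma> \<bullet> \<alpha> \<noteq> 0" if "\<alpha> \<in> Phi_plus P \<gamma>" for \<alpha>
    proof
      assume orth: "\<gamma> \<bullet> \<alpha> = 0"
      have mem: "\<alpha> \<in> P" "\<gamma> - \<alpha> \<in> P" using that by (auto simp: Phi_plus_def)
      then have "\<alpha> \<noteq> 0" using zero by auto
      \<comment> \<open>Under orthogonality this reflection fixes \<gamma> and negates \<alpha>, so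
        it would turn the root \<gamma> - \<alpha> into the excluded sum \<gamma> +
        \<alpha>.\<close>
      then have "reflection \<alpha> (\<gamma> - \<alpha>) = \<gamma> + \<alpha>"
        using orth by (simp add: reflection_def inner_diff_left scaleR_2)
      then show False
        using maximal mem reflection_root[OF less.prems(1), of \<alpha> "\<gamma> - \<alpha>"] by (auto simp: P_def)
    qed
    define D where "D = {\<alpha> \<in> \<Delta>. \<gamma> \<bullet> \<alpha> = 0}"
    define Q where "Q = {\<alpha> \<in> D. h \<alpha> > 0}"
    have Q_alt: "Q = {\<alpha> \<in> P. \<gamma> \<bullet> \<alpha> = 0}"
      by (auto simp: Q_def D_def P_def)
    have "\<gamma> \<noteq> 0" using zero \<open>\<gamma> \<in> P\<close> by auto
    then have "\<gamma> \<notin> D" by (simp add: D_def)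
    have "\<alpha> \<in> insert \<gamma> (Phi_plus P \<gamma>) \<or> \<gamma> \<bullet> \<alpha> = 0" if "\<alpha> \<in> P" for \<alpha>
      using in_Phi[OF that] dominant[OF that] by force
    then have Q: "Q = P - insert \<gamma> (Phi_plus P \<gamma>)"
      using Phi_not_orth \<open>\<gamma> \<noteq> 0\<close> unfolding Q_alt by auto
    have Phi: "Phi_plus P \<delta> = Phi_plus Q \<delta>" if "\<delta> \<in> Q" for \<delta>
    proof -
      \<comment> \<open>Both summands of \<delta> have non-negative product with \<gamma>, and these
        products add up to 0. Hence every decomposition of \<delta> in \<open>P\<close> already
        takes place in \<open>Q\<close>.\<close>
      have "\<gamma> \<bullet> \<alpha> = 0 \<and> \<gamma> \<bullet> (\<delta> - \<alpha>) = 0" if "\<alpha> \<in> P" "\<delta> - \<alpha> \<in> P" for \<alpha>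
        using dominant[OF that(1)] dominant[OF that(2)] \<open>\<delta> \<in> Q\<close>
        by (auto simp: Q_alt inner_diff_right)
      then show ?thesis by (auto simp: Phi_plus_def Q_alt)
    qed
    have reduce: "is_stem P \<Gamma> \<longleftrightarrow> \<gamma> \<in> \<Gamma> \<and> is_stem Q (\<Gamma> - {\<gamma>})" for \<Gamma>
      by (rule is_stem_reduce[OF \<open>\<gamma> \<in> P\<close> zero _ Q Phi]) (use maximal in \<open>auto simp: P_def\<close>)
    have "D \<subset> \<Delta>"
      using \<open>\<gamma> \<in> \<Delta>\<close> \<open>\<gamma> \<notin> D\<close> D_def by blast
    then have "card D < card \<Delta>"
      by (rule psubset_card_mono[OF fin])
    moreover have "root_system (span D) D"
      unfolding D_def by (rule root_system_orthogonal[OF less.prems(1)])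
    ultimately have "\<exists>!\<Gamma>. is_stem Q \<Gamma>"
      unfolding Q_def by (rule less.hyps) (use less.prems(2) in \<open>auto simp: D_def\<close>)
    then obtain \<Gamma>' where \<Gamma>': "is_stem Q \<Gamma>'" and unique: "\<And>\<Gamma>. is_stem Q \<Gamma> \<Longrightarrow> \<Gamma> = \<Gamma>'"
      by blast
    have "\<gamma> \<notin> \<Gamma>'"
      using \<Gamma>' \<open>\<gamma> \<notin> D\<close> by (auto simp: is_stem_def Q_def)
    then have "is_stem P (insert \<gamma> \<Gamma>')"
      using reduce \<Gamma>' by simp
    moreover have "\<Gamma> = insert \<gamma> \<Gamma>'" if "is_stem P \<Gamma>" for \<Gamma>
      using that unique[of "\<Gamma> - {\<gamma>}"] unfolding reduce by blast
    ultimately show ?thesis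
      unfolding P_def by blast
  qed
qed

section \<open>From a basis to a functional\<close>

lemma root_basis_functional:
  assumes "root_system V \<Delta>" "root_basis V \<Delta> B"
  obtains h :: "'a::real_inner \<Rightarrow> real"
  where "linear h" "\<And>\<alpha>. \<alpha> \<in> \<Delta> \<Longrightarrow> h \<alpha> \<noteq> 0" "positive_roots \<Delta> B = {\<alpha> \<in> \<Delta>. h \<alpha> > 0}"
proof -
  have "independent B" "finite B" "0 \<notin> \<Delta>"
    using assms finite_subset by (auto simp: root_system_def root_basis_def)
  \<comment> \<open>This \<open>h\<close> is the height: on a root it is the sum of the coefficients
    over the basis.\<close>
  obtain h :: "'a \<Rightarrow> real" where "linear h" and one: "\<forall>\<alpha>\<in>B. h \<alpha> = 1"
    using linear_independent_extend[OF \<open>independent B\<close>, of "\<lambda>_. 1"] by auto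
  have h_sum: "h (\<Sum>\<alpha>\<in>B. of_int (c \<alpha>) *\<^sub>R \<alpha>) = of_int (\<Sum>\<alpha>\<in>B. c \<alpha>)" for c :: "'a \<Rightarrow> int"
    using one by (simp add: linear_sum[OF \<open>linear h\<close>] linear_cmul[OF \<open>linear h\<close>])
  have pos: "h \<beta> > 0"
    if "\<beta> \<in> \<Delta>" "\<beta> = (\<Sum>\<alpha>\<in>B. of_int (c \<alpha>) *\<^sub>R \<alpha>)" "\<forall>\<alpha>\<in>B. c \<alpha> \<ge> 0" for \<beta> and c :: "'a \<Rightarrow> int"
  proof -
    \<comment> \<open>Not all coefficients vanish because 0 is not a root; with non-negative
      integers this makes the height positive.\<close>
    have "\<exists>\<alpha>\<in>B. c \<alpha> \<noteq> 0"
      using that(1,2) \<open>0 \<notin> \<Delta>\<close> by (metis (no_types, lifting) of_int_0 scaleR_zero_left sum.neutral)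
    then have "(\<Sum>\<alpha>\<in>B. c \<alpha>) > 0"
      using that(3) \<open>finite B\<close> by (metis order_le_less sum_pos2)
    then show ?thesis
      unfolding that(2) h_sum by (simp only: of_int_0_less_iff)
  qed
  have dichotomy: "h \<beta> > 0 \<and> \<beta> \<in> positive_roots \<Delta> B \<or> h \<beta> < 0" if "\<beta> \<in> \<Delta>" for \<beta>
  proof -
    have "\<exists>c :: 'a \<Rightarrow> int. \<beta> = (\<Sum>\<alpha>\<in>B. of_int (c \<alpha>) *\<^sub>R \<alpha>) \<and>
        ((\<forall>\<alpha>\<in>B. c \<alpha> \<ge> 0) \<or> (\<forall>\<alpha>\<in>B. c \<alpha> \<le> 0))"
      using assms(2) that by (simp only: root_basis_def)
    then obtain c :: "'a \<Rightarrow> int" where c: "\<beta> = (\<Sum>\<alpha>\<in>B. of_int (c \<alpha>) *\<^sub>R \<alpha>)"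
      and "(\<forall>\<alpha>\<in>B. c \<alpha> \<ge> 0) \<or> (\<forall>\<alpha>\<in>B. c \<alpha> \<le> 0)"
      by (elim exE conjE)
    then consider "\<forall>\<alpha>\<in>B. c \<alpha> \<ge> 0" | "\<forall>\<alpha>\<in>B. c \<alpha> \<le> 0" by blast
    then show ?thesis
    proof cases
      case 1
      then have "\<beta> \<in> positive_roots \<Delta> B"
        unfolding positive_roots_def by (intro CollectI conjI exI[of _ c] that c)
      then show ?thesis using pos[OF that c 1] by blast
    next
      case 2
      \<comment> \<open>The root -\<beta> has the negated, hence non-negative, coefficients, so the
        previous case applies to it.\<close>
      have "h (- \<beta>) > 0"
        by (rule pos[of _ "\<lambda>\<alpha>. - c \<alpha>"])
          (use 2 c minus_root[OF assms(1) that] in \<open>auto simp: sum_negf\<close>)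
      then show ?thesis
        by (simp add: linear_neg[OF \<open>linear h\<close>])
    qed
  qed
  have "positive_roots \<Delta> B = {\<alpha> \<in> \<Delta>. h \<alpha> > 0}"
  proof
    show "positive_roots \<Delta> B \<subseteq> {\<alpha> \<in> \<Delta>. h \<alpha> > 0}"
      by (auto simp only: positive_roots_def mem_Collect_eq intro: pos)
    show "{\<alpha> \<in> \<Delta>. h \<alpha> > 0} \<subseteq> positive_roots \<Delta> B"
      using dichotomy by force
  qed
  moreover have "h \<alpha> \<noteq> 0" if "\<alpha> \<in> \<Delta>" for \<alpha>
    using dichotomy[OF that] by auto
  ultimately show thesis
    using that \<open>linear h\<close> by blast
qed

theorem theorem2p12:
  fixes V \<Delta> B :: "'a::real_inner set"
  assumes "reduced_root_system V \<Delta>"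
    and "root_basis V \<Delta> B"
  shows "\<exists>!\<Gamma>. is_stem (positive_roots \<Delta> B) \<Gamma>"
proof -
  have "root_system V \<Delta>"
    using assms(1) by (simp add: reduced_root_system_def)
  then obtain h :: "'a \<Rightarrow> real" where "linear h" "\<And>\<alpha>. \<alpha> \<in> \<Delta> \<Longrightarrow> h \<alpha> \<noteq> 0"
    and P: "positive_roots \<Delta> B = {\<alpha> \<in> \<Delta>. h \<alpha> > 0}"
    using root_basis_functional[OF _ assms(2)] by blast
  with \<open>root_system V \<Delta>\<close> show ?thesis
    unfolding P by (intro stem_unique_functional)
qed

end
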